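(* Let $a,d$ be real numbers with $d\geqslant a\geqslant1$. Then the sequence $\{P_n(q,a,d)\}_{n\geqslant0}$ of general Eulerian polynomials associated with the arithmetic progression $\{a,a+d,a+2d,a+3d,\ldots\}$ is strongly $q$-log-convex.
   Context: The general Eulerian numbers $A_{n,k}(a,d)$ associated with the arithmetic progression $\{a,a+d,a+2d,\ldots\}$ are defined by $A_{0,-1}(a,d)=1$, $A_{n,k}(a,d)=0$ for $k\geqslant n$ or $k\leqslant-2$, and, for $n\geqslant1$ and $-1\leqslant k\leqslant n-1$, $$A_{n,k}(a,d)=(-a+(k+2)d)A_{n-1,k}(a,d)+(a+(n-k-1)d)A_{n-1,k-1}(a,d).$$ The general Eulerian polynomials are $P_n(q,a,d)=\sum_{k=-1}^{n-1}A_{n,k}(a,d)q^{k+1}$ for $n\geqslant0$ (so $P_0(q,a,d)=1$). For real polynomials $f(q),g(q)$, write $f(q)\geqslant_q g(q)$ if $f(q)-g(q)$ has only nonnegative coefficients as a polynomial in $q$. A sequence $\{f_n(q)\}_{n\geqslant0}$ of real polynomials is strongly $q$-log-convex if $f_{m-1}(q)f_{n+1}(q)\geqslant_q f_m(q)f_n(q)$ for all $n\geqslant m\geqslant 1$. *)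

theory Defs
  imports Complex_Main "HOL-Computational_Algebra.Polynomial"
begin

fun gen_eulerian :: "nat \<Rightarrow> int \<Rightarrow> real \<Rightarrow> real \<Rightarrow> real" where
  "gen_eulerian 0 k a d = (if k = -1 then 1 else 0)"
| "gen_eulerian (Suc m) k a d =
     (if k \<ge> int (Suc m) \<or> k \<le> -2 then 0
      else (- a + of_int (k + 2) * d) * gen_eulerian m k a d
         + (a + of_int (int (Suc m) - k - 1) * d) * gen_eulerian m (k - 1) a d)"

text \<open>The index \<open>k\<close> starts at \<open>-1\<close>, hence the exponent \<open>k + 1\<close> is a natural number.\<close>

definition gen_eulerian_poly :: "nat \<Rightarrow> real \<Rightarrow> real \<Rightarrow> real poly" where
  "gen_eulerian_poly n a d =
     (\<Sum>k\<in>{-1..int n - 1}. monom (gen_eulerian n k a d) (nat (k + 1)))"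

definition q_ge :: "real poly \<Rightarrow> real poly \<Rightarrow> bool"  (infix "\<ge>\<^sub>q" 50) where
  "f \<ge>\<^sub>q g \<longleftrightarrow> (\<forall>i. coeff (f - g) i \<ge> 0)"

definition strongly_q_log_convex :: "(nat \<Rightarrow> real poly) \<Rightarrow> bool" where
  "strongly_q_log_convex f \<longleftrightarrow>
     (\<forall>n m. n \<ge> m \<and> m \<ge> 1 \<longrightarrow> f (m - 1) * f (n + 1) \<ge>\<^sub>q f m * f n)"

end

theory Submission
  imports Defs
begin

text \<open>
  The polynomials \<open>P\<^sub>n\<close> are the moments of a Jacobi continued fraction with coefficients
  \<open>s\<^sub>k = (d - a + k d) + (a + k d) q\<close> and \<open>t\<^sub>k = (k + 1)\<^sup>2 d\<^sup>2 q\<close>.  Equivalently, they form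
  column \<open>0\<close> of the triangle \<open>M\<close> that starts with the unit row and whose next row is always the
  last one times the tridiagonal matrix with superdiagonal \<open>1\<close>, diagonal \<open>s\<close> and subdiagonal
  \<open>t\<close> (\<open>moment_triangle\<close>).  Since \<open>P\<^sub>n\<^sub>+\<^sub>1 = s\<^sub>0 M\<^sub>n\<^sub>,\<^sub>0 + t\<^sub>0 M\<^sub>n\<^sub>,\<^sub>1\<close>, the diagonal part cancels in
  \<open>P\<^sub>m\<^sub>-\<^sub>1 P\<^sub>n\<^sub>+\<^sub>1 - P\<^sub>m P\<^sub>n\<close>, which is therefore \<open>t\<^sub>0\<close> times the minor of \<open>M\<close> on rows \<open>m - 1\<close>, \<open>n\<close> and
  columns \<open>0\<close>, \<open>1\<close>.

  It thus suffices that the \<open>2 \<times> 2\<close> minors of \<open>M\<close> have nonnegative coefficients.  By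
  Cauchy-Binet, a step of the recurrence turns minors into combinations of minors; the only
  negative weight is a \<open>-t\<^sub>k\<close> attached to a minor that also occurs with weight \<open>s\<^sub>k s\<^sub>k\<^sub>+\<^sub>1\<close>.  Hence
  everything reduces to \<open>s\<^sub>k s\<^sub>k\<^sub>+\<^sub>1 \<ge>\<^sub>q t\<^sub>k\<close> (\<open>moment_triangle_minor_nonneg\<close>), and this holds when
  \<open>d \<ge> a \<ge> 0\<close> (\<open>eulerian_weights_dominate\<close>).

  That column \<open>0\<close> is \<open>P\<^sub>n\<close> can be read off from exponential generating functions.  With
  \<open>E = exp (d x (1 - q))\<close>, column \<open>k\<close> has generating function \<open>F G\<^sup>k / k!\<close>, where
  \<open>F = (1 - q) exp ((d - a) x (1 - q)) / (1 - q E)\<close> and \<open>G = (E - 1) / (d (1 - q E))\<close>.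
  The derivation \<open>q x \<partial>\<^sub>x + q (1 - q) \<partial>\<^sub>q\<close> annihilates \<open>x (1 - q)\<close> and hence \<open>E\<close>, and its
  effect on \<open>F G\<^sup>k / k!\<close> amounts to a differential relation between columns \<open>k\<close> and \<open>k + 1\<close>.
  This relation is verified by induction on the rows (\<open>pderiv_eulerian_triangle\<close>); for \<open>k = 0\<close>
  it turns the tridiagonal recurrence into the recurrence of the Eulerian polynomials.
\<close>

section \<open>Polynomials with nonnegative coefficients\<close>

lemma q_ge_0_iff: "f \<ge>\<^sub>q 0 \<longleftrightarrow> (\<forall>i. coeff f i \<ge> 0)"
  by (simp add: q_ge_def)

lemma q_ge_iff_diff: "f \<ge>\<^sub>q g \<longleftrightarrow> f - g \<ge>\<^sub>q 0"
  by (simp add: q_ge_def)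

lemma q_ge_0_add: "f \<ge>\<^sub>q 0 \<Longrightarrow> g \<ge>\<^sub>q 0 \<Longrightarrow> f + g \<ge>\<^sub>q 0"
  by (simp add: q_ge_0_iff)

lemma q_ge_0_mult: "f \<ge>\<^sub>q 0 \<Longrightarrow> g \<ge>\<^sub>q 0 \<Longrightarrow> f * g \<ge>\<^sub>q 0"
  by (simp add: q_ge_0_iff coeff_mult sum_nonneg)

lemma q_ge_0_zero: "0 \<ge>\<^sub>q 0"
  by (simp add: q_ge_0_iff)

lemma q_ge_0_one: "1 \<ge>\<^sub>q 0"
  by (simp add: q_ge_0_iff coeff_1)

lemma q_ge_0_pCons: "c \<ge> 0 \<Longrightarrow> f \<ge>\<^sub>q 0 \<Longrightarrow> pCons c f \<ge>\<^sub>q 0"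
  by (simp add: q_ge_0_iff coeff_pCons split: nat.split)

lemmas q_ge_0_intros = q_ge_0_add q_ge_0_mult q_ge_0_zero q_ge_0_one q_ge_0_pCons

section \<open>Tridiagonal recurrences and their minors\<close>

text \<open>
  Multiplication of the row vector \<open>v\<close> by the tridiagonal matrix.  The row is first moved one
  place to the right behind a zero, so that column \<open>0\<close> needs no separate treatment.
\<close>

definition shift_row :: "(nat \<Rightarrow> 'a::zero) \<Rightarrow> nat \<Rightarrow> 'a" where
  "shift_row v k = (case k of 0 \<Rightarrow> 0 | Suc j \<Rightarrow> v j)"

definition tridiagonal_step ::
  "(nat \<Rightarrow> 'a::comm_ring_1) \<Rightarrow> (nat \<Rightarrow> 'a) \<Rightarrow> (nat \<Rightarrow> 'a) \<Rightarrow> nat \<Rightarrow> 'a" where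
  "tridiagonal_step s t v k = shift_row v k + s k * v k + t k * v (Suc k)"

fun moment_triangle ::
  "(nat \<Rightarrow> 'a::comm_ring_1) \<Rightarrow> (nat \<Rightarrow> 'a) \<Rightarrow> nat \<Rightarrow> nat \<Rightarrow> 'a" where
  "moment_triangle s t 0 = (\<lambda>k. if k = 0 then 1 else 0)"
| "moment_triangle s t (Suc n) = tridiagonal_step s t (moment_triangle s t n)"

definition minor :: "(nat \<Rightarrow> 'a::comm_ring_1) \<Rightarrow> (nat \<Rightarrow> 'a) \<Rightarrow> nat \<Rightarrow> nat \<Rightarrow> 'a" where
  "minor v w k l = v k * w l - w k * v l"

lemma tridiagonal_step_shift_row:
  "tridiagonal_step s t v k
     = shift_row v k + s k * shift_row v (Suc k) + t k * shift_row v (Suc (Suc k))"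
  by (simp add: tridiagonal_step_def shift_row_def)

lemma minor_shift_row_nonneg:
  assumes "\<And>k l. k < l \<Longrightarrow> minor v w k l \<ge>\<^sub>q 0" and "k \<le> l"
  shows "minor (shift_row v) (shift_row w) k l \<ge>\<^sub>q 0"
proof (cases "k = l")
  case True
  then show ?thesis by (simp add: minor_def q_ge_0_zero)
next
  case False
  then have "k < l" using assms(2) by simp
  then show ?thesis
    using assms(1)[of "k - 1" "l - 1"]
    by (cases k; cases l) (simp_all add: minor_def shift_row_def q_ge_0_zero)
qed

lemma tridiagonal_step_nonneg:
  assumes "\<And>k. v k \<ge>\<^sub>q 0" and "\<And>k. s k \<ge>\<^sub>q 0" and "\<And>k. t k \<ge>\<^sub>q 0"
  shows "tridiagonal_step s t v k \<ge>\<^sub>q 0"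
proof -
  have "shift_row v k \<ge>\<^sub>q 0"
    using assms(1) by (simp add: shift_row_def q_ge_0_zero split: nat.split)
  then show ?thesis
    unfolding tridiagonal_step_def by (intro q_ge_0_intros assms)
qed

text \<open>
  Two columns \<open>k < l\<close> of the tridiagonal matrix each have three entries, so the new minor is a
  combination of nine old ones.  Unless \<open>l = k + 1\<close>, all nine have their columns in weakly
  increasing order.
\<close>

lemma tridiagonal_step_minor_nonneg:
  assumes minors: "\<And>k l. k < l \<Longrightarrow> minor v w k l \<ge>\<^sub>q 0"
    and s: "\<And>k. s k \<ge>\<^sub>q 0" and t: "\<And>k. t k \<ge>\<^sub>q 0"
    and dominate: "\<And>k. s k * s (Suc k) - t k \<ge>\<^sub>q 0"
    and "k < l"
  shows "minor (tridiagonal_step s t v) (tridiagonal_step s t w) k l \<ge>\<^sub>q 0"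
proof -
  define D where "D = minor (shift_row v) (shift_row w)"
  have D: "D i j \<ge>\<^sub>q 0" if "i \<le> j" for i j
    unfolding D_def by (rule minor_shift_row_nonneg[OF minors that])
  show ?thesis
  proof (cases "l = Suc k")
    case True
    \<comment> \<open>Two of the nine minors vanish because their columns coincide.  The minor of the shifted rows
      on columns \<open>k + 2, k + 1\<close> has weight \<open>t k\<close> and is the negated minor on \<open>k + 1, k + 2\<close>, whose own
      weight \<open>s k * s (Suc k)\<close> absorbs it.\<close>
    have "minor (tridiagonal_step s t v) (tridiagonal_step s t w) k l
        = D k (k + 1) + s (k + 1) * D k (k + 2) + t (k + 1) * D k (k + 3)
        + (s k * s (Suc k) - t k) * D (k + 1) (k + 2) + s k * t (k + 1) * D (k + 1) (k + 3)
        + t k * t (k + 1) * D (k + 2) (k + 3)"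
      unfolding True minor_def D_def tridiagonal_step_shift_row
      by (simp add: algebra_simps eval_nat_numeral)
    also have "\<dots> \<ge>\<^sub>q 0"
      by (intro q_ge_0_add q_ge_0_mult D s t dominate) simp_all
    finally show ?thesis .
  next
    case False
    then have "k + 2 \<le> l" using \<open>k < l\<close> by simp
    have "minor (tridiagonal_step s t v) (tridiagonal_step s t w) k l
        = D k l + s l * D k (l + 1) + t l * D k (l + 2)
        + s k * D (k + 1) l + s k * s l * D (k + 1) (l + 1) + s k * t l * D (k + 1) (l + 2)
        + t k * D (k + 2) l + t k * s l * D (k + 2) (l + 1) + t k * t l * D (k + 2) (l + 2)"
      unfolding minor_def D_def tridiagonal_step_shift_row
      by (simp add: algebra_simps)
    also have "\<dots> \<ge>\<^sub>q 0"
      using \<open>k + 2 \<le> l\<close> by (intro q_ge_0_add q_ge_0_mult D s t) simp_all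
    finally show ?thesis .
  qed
qed

lemma moment_triangle_nonneg:
  assumes "\<And>k. s k \<ge>\<^sub>q 0" and "\<And>k. t k \<ge>\<^sub>q 0"
  shows "moment_triangle s t n k \<ge>\<^sub>q 0"
proof (induction n arbitrary: k)
  case 0
  show ?case by (simp add: q_ge_0_zero q_ge_0_one)
next
  case (Suc n)
  then show ?case by (simp add: tridiagonal_step_nonneg assms)
qed

text \<open>
  Both rows are advanced simultaneously, keeping their distance \<open>r\<close>.  When the upper one is row
  \<open>0\<close>, the minor is \<open>0\<close> or an entry of the triangle.
\<close>

lemma moment_triangle_minor_nonneg:
  assumes "\<And>k. s k \<ge>\<^sub>q 0" and "\<And>k. t k \<ge>\<^sub>q 0" and "\<And>k. s k * s (Suc k) - t k \<ge>\<^sub>q 0"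
    and "k < l"
  shows "minor (moment_triangle s t n) (moment_triangle s t (n + r)) k l \<ge>\<^sub>q 0"
  using \<open>k < l\<close>
proof (induction n arbitrary: k l)
  case 0
  then show ?case
    by (simp add: minor_def q_ge_0_zero moment_triangle_nonneg assms)
next
  case (Suc n)
  show ?case
    using tridiagonal_step_minor_nonneg[where s = s and t = t, OF Suc.IH assms(1-3) Suc.prems]
    by simp
qed

text \<open>
  In \<open>M\<^sub>i\<^sub>,\<^sub>0 M\<^sub>n\<^sub>+\<^sub>1\<^sub>,\<^sub>0 - M\<^sub>i\<^sub>+\<^sub>1\<^sub>,\<^sub>0 M\<^sub>n\<^sub>,\<^sub>0\<close> the terms with \<open>s\<^sub>0\<close> cancel, which leaves \<open>t\<^sub>0\<close> times the minor
  on rows \<open>i, n\<close> and columns \<open>0, 1\<close>.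
\<close>

theorem moments_strongly_q_log_convex:
  assumes "\<And>k. s k \<ge>\<^sub>q 0" and "\<And>k. t k \<ge>\<^sub>q 0" and "\<And>k. s k * s (Suc k) - t k \<ge>\<^sub>q 0"
  shows "strongly_q_log_convex (\<lambda>n. moment_triangle s t n 0)"
  unfolding strongly_q_log_convex_def
proof (intro allI impI)
  fix n m :: nat
  assume nm: "m \<le> n \<and> 1 \<le> m"
  define M where "M = moment_triangle s t"
  have M_Suc: "M (Suc i) 0 = s 0 * M i 0 + t 0 * M i 1" for i
    by (simp add: M_def tridiagonal_step_def shift_row_def)
  obtain i where m: "m = Suc i" using nm by (cases m) auto
  have "minor (M i) (M (i + (n - i))) 0 1 \<ge>\<^sub>q 0"
    unfolding M_def by (rule moment_triangle_minor_nonneg[where s = s and t = t, OF assms]) simp_all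
  then have "minor (M i) (M n) 0 1 \<ge>\<^sub>q 0"
    using nm m by simp
  then have "t 0 * minor (M i) (M n) 0 1 \<ge>\<^sub>q 0"
    by (intro q_ge_0_mult assms)
  also have "t 0 * minor (M i) (M n) 0 1 = M (m - 1) 0 * M (n + 1) 0 - M m 0 * M n 0"
    by (simp add: m M_Suc minor_def algebra_simps)
  finally show "M (m - 1) 0 * M (n + 1) 0 \<ge>\<^sub>q M m 0 * M n 0"
    by (subst q_ge_iff_diff)
qed

section \<open>The continued fraction of the Eulerian polynomials\<close>

lemma gen_eulerian_eq_0:
  "k \<ge> int n \<Longrightarrow> k \<ge> 0 \<Longrightarrow> gen_eulerian n k a d = 0"
  "k \<le> -2 \<Longrightarrow> gen_eulerian n k a d = 0"
  by (cases n; simp)+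

lemma coeff_gen_eulerian_poly:
  "coeff (gen_eulerian_poly n a d) j = gen_eulerian n (int j - 1) a d"
proof -
  have "coeff (gen_eulerian_poly n a d) j
      = (\<Sum>k\<in>{-1..int n - 1}. if k = int j - 1 then gen_eulerian n k a d else 0)"
    unfolding gen_eulerian_poly_def coeff_sum by (intro sum.cong refl) auto
  also have "\<dots> = gen_eulerian n (int j - 1) a d"
    by (auto simp: gen_eulerian_eq_0)
  finally show ?thesis .
qed

lemma gen_eulerian_poly_0: "gen_eulerian_poly 0 a d = 1"
  by (rule poly_eqI) (simp add: coeff_gen_eulerian_poly coeff_1)

text \<open>
  For \<open>k > n\<close> and for \<open>k \<le> -2\<close> both entries on the right vanish, so the recurrence holds without a
  case distinction; this is what allows it to be summed into one for polynomials.
\<close>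

lemma gen_eulerian_Suc:
  "gen_eulerian (Suc n) k a d
     = (- a + of_int (k + 2) * d) * gen_eulerian n k a d
       + (a + of_int (int n - k) * d) * gen_eulerian n (k - 1) a d"
  by (simp add: gen_eulerian_eq_0)

lemma gen_eulerian_poly_Suc:
  "gen_eulerian_poly (Suc n) a d
     = [:d - a, a + of_nat n * d:] * gen_eulerian_poly n a d
       + [:0, d, -d:] * pderiv (gen_eulerian_poly n a d)"
proof (rule poly_eqI)
  fix j
  show "coeff (gen_eulerian_poly (Suc n) a d) j
      = coeff ([:d - a, a + of_nat n * d:] * gen_eulerian_poly n a d
          + [:0, d, -d:] * pderiv (gen_eulerian_poly n a d)) j"
  proof (cases j)
    case 0
    then show ?thesis
      by (simp add: coeff_gen_eulerian_poly gen_eulerian_Suc gen_eulerian_eq_0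
          del: gen_eulerian.simps)
  next
    case (Suc i)
    then show ?thesis
      by (cases i) (simp_all add: coeff_gen_eulerian_poly gen_eulerian_Suc coeff_pderiv
          algebra_simps del: gen_eulerian.simps)
  qed
qed

definition eulerian_diag :: "real \<Rightarrow> real \<Rightarrow> nat \<Rightarrow> real poly" where
  "eulerian_diag a d k = [:d - a + of_nat k * d, a + of_nat k * d:]"

definition eulerian_subdiag :: "real \<Rightarrow> nat \<Rightarrow> real poly" where
  "eulerian_subdiag d k = [:0, (of_nat (Suc k) * d)\<^sup>2:]"

abbreviation eulerian_triangle :: "real \<Rightarrow> real \<Rightarrow> nat \<Rightarrow> nat \<Rightarrow> real poly" where
  "eulerian_triangle a d \<equiv> moment_triangle (eulerian_diag a d) (eulerian_subdiag d)"

text \<open>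
  This is the action of \<open>q x \<partial>\<^sub>x + q (1 - q) \<partial>\<^sub>q\<close> on the generating function of column \<open>k\<close>, read off
  coefficient by coefficient and divided by \<open>q\<close>.  In the induction step, the recurrence expresses row
  \<open>n + 1\<close> in terms of the columns \<open>k - 1\<close>, \<open>k\<close>, \<open>k + 1\<close> of row \<open>n\<close>; the induction hypotheses for these
  columns, with the weights \<open>1\<close>, \<open>s\<^sub>k\<close>, \<open>t\<^sub>k\<close>, remove all derivatives of entries, and what remains is
  an identity that can be compared at every point \<open>x\<close>.
\<close>

lemma pderiv_eulerian_triangle:
  "[:1, -1:] * pderiv (eulerian_triangle a d n k)
     = [:of_nat k - of_nat n:] * eulerian_triangle a d n k
       + [:(of_nat (Suc k))\<^sup>2 * d:] * eulerian_triangle a d n (Suc k)"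
proof (induction n arbitrary: k)
  case 0
  show ?case by (auto simp: pderiv_1)
next
  case (Suc n)
  let ?M = "eulerian_triangle a d n"
  show ?case
  proof (intro poly_eq_poly_eq_iff[THEN iffD1] ext)
    fix x
    define V where "V j = poly (?M j) x" for j
    define V' where "V' j = poly (pderiv (?M j)) x" for j
    define W where "W = poly (shift_row ?M k) x"
    define W' where "W' = poly (pderiv (shift_row ?M k)) x"
    define \<kappa> where "\<kappa> = real k"
    define \<nu> where "\<nu> = real n"
    have IH: "(1 - x) * V' j = (real j - \<nu>) * V j + (real j + 1)\<^sup>2 * d * V (Suc j)" for j
      using arg_cong[OF Suc.IH[of j], of "\<lambda>p. poly p x"]
      by (simp add: V_def V'_def \<nu>_def algebra_simps)
    have IH_k: "(1 - x) * V' k = (\<kappa> - \<nu>) * V k + (\<kappa> + 1)\<^sup>2 * d * V (Suc k)"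
      using IH[of k] by (simp add: \<kappa>_def)
    have IH_Suc_k:
      "(1 - x) * V' (Suc k)
         = (\<kappa> + 1 - \<nu>) * V (Suc k) + (\<kappa> + 2)\<^sup>2 * d * V (Suc (Suc k))"
      using IH[of "Suc k"] by (simp add: \<kappa>_def algebra_simps)
    \<comment> \<open>For \<open>k = 0\<close> this holds trivially, as the shifted row starts with \<open>0\<close>.\<close>
    have IH_shift: "(1 - x) * W' = (\<kappa> - 1 - \<nu>) * W + \<kappa>\<^sup>2 * d * V k"
    proof (cases k)
      case 0
      then show ?thesis by (simp add: W_def W'_def \<kappa>_def shift_row_def)
    next
      case (Suc j)
      then show ?thesis
        using IH[of j] by (simp add: W_def W'_def V_def V'_def \<kappa>_def shift_row_def algebra_simps)
    qed
    define s where "s = d - a + \<kappa> * d + (a + \<kappa> * d) * x"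
    define t where "t = ((\<kappa> + 1) * d)\<^sup>2 * x"
    have "poly ([:1, -1:] * pderiv (eulerian_triangle a d (Suc n) k)) x
        = (1 - x) * W' + (1 - x) * (a + \<kappa> * d) * V k + s * ((1 - x) * V' k)
          + (1 - x) * ((\<kappa> + 1) * d)\<^sup>2 * V (Suc k) + t * ((1 - x) * V' (Suc k))"
      by (simp add: tridiagonal_step_def pderiv_add pderiv_mult pderiv_smult pderiv_pCons eulerian_diag_def
          eulerian_subdiag_def W'_def V_def V'_def s_def t_def \<kappa>_def algebra_simps)
    also have "\<dots> = (\<kappa> - (\<nu> + 1)) * (W + s * V k + t * V (Suc k))
        + (\<kappa> + 1)\<^sup>2 * d * (V k + (s + d + d * x) * V (Suc k)
            + ((\<kappa> + 2) * d)\<^sup>2 * x * V (Suc (Suc k)))"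
      unfolding IH_k IH_Suc_k IH_shift s_def t_def
      by (simp add: algebra_simps power2_eq_square)
    also have "\<dots> = poly ([:of_nat k - of_nat (Suc n):] * eulerian_triangle a d (Suc n) k
        + [:(of_nat (Suc k))\<^sup>2 * d:] * eulerian_triangle a d (Suc n) (Suc k)) x"
      by (simp add: tridiagonal_step_def shift_row_def[of _ "Suc k"] eulerian_diag_def
          eulerian_subdiag_def W_def V_def s_def t_def \<kappa>_def \<nu>_def algebra_simps)
    finally show "poly ([:1, -1:] * pderiv (eulerian_triangle a d (Suc n) k)) x = \<dots>" .
  qed
qed

text \<open>
  In column \<open>0\<close>, the differential relation expresses the neighbouring entry in column \<open>1\<close> by a
  derivative, which is the derivative in the recurrence of the Eulerian polynomials.
\<close>

lemma gen_eulerian_poly_eq_moment: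
  "gen_eulerian_poly n a d = eulerian_triangle a d n 0"
proof (induction n)
  case 0
  show ?case by (simp add: gen_eulerian_poly_0)
next
  case (Suc n)
  let ?M = "eulerian_triangle a d"
  have "[:0, d, -d:] * pderiv (?M n 0) = [:0, d:] * ([:1, -1:] * pderiv (?M n 0))"
    by (simp add: algebra_simps)
  also have "\<dots> = [:0, d:] * ([:- of_nat n:] * ?M n 0 + [:d:] * ?M n 1)"
    unfolding pderiv_eulerian_triangle by simp
  finally have differential:
    "[:0, d, -d:] * pderiv (?M n 0) = [:0, d:] * ([:- of_nat n:] * ?M n 0 + [:d:] * ?M n 1)" .
  show ?case
    unfolding gen_eulerian_poly_Suc Suc.IH differential
    by (rule poly_eq_poly_eq_iff[THEN iffD1])
      (simp add: fun_eq_iff tridiagonal_step_def shift_row_def eulerian_diag_def[of a d 0]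
        eulerian_subdiag_def[of d 0] algebra_simps power2_eq_square)
qed

text \<open>
  Only the coefficient of \<open>q\<close> is affected by the subtraction.  Written in \<open>x = d - a\<close> and \<open>u = k d\<close>,
  what is left of it is a sum of products of nonnegative numbers.
\<close>

lemma eulerian_weights_dominate:
  assumes "d \<ge> a" and "a \<ge> 0"
  shows "eulerian_diag a d k * eulerian_diag a d (Suc k) - eulerian_subdiag d k \<ge>\<^sub>q 0"
proof -
  define x where "x = d - a"
  define u where "u = real k * d"
  have nn: "x \<ge> 0" "u \<ge> 0" "d \<ge> 0" using assms by (simp_all add: x_def u_def)
  have "eulerian_diag a d k * eulerian_diag a d (Suc k) - eulerian_subdiag d k
      = [:(x + u) * (x + u + d),
          2 * a * x + 2 * u * d + u\<^sup>2,
          (a + u) * (a + u + d):]"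
    by (simp add: eulerian_diag_def eulerian_subdiag_def x_def u_def algebra_simps
        power2_eq_square)
  also have "\<dots> \<ge>\<^sub>q 0"
    using nn assms by (intro q_ge_0_intros) simp_all
  finally show ?thesis .
qed

theorem proposition3p5:
  fixes a d :: real
  assumes "d \<ge> a" and "a \<ge> 1"
  shows "strongly_q_log_convex (\<lambda>n. gen_eulerian_poly n a d)"
proof -
  have "strongly_q_log_convex (\<lambda>n. eulerian_triangle a d n 0)"
  proof (rule moments_strongly_q_log_convex)
    fix k
    show "eulerian_diag a d k \<ge>\<^sub>q 0"
      unfolding eulerian_diag_def using assms by (intro q_ge_0_intros) simp_all
    show "eulerian_subdiag d k \<ge>\<^sub>q 0"
      unfolding eulerian_subdiag_def by (intro q_ge_0_intros) simp_all
    show "eulerian_diag a d k * eulerian_diag a d (Suc k) - eulerian_subdiag d k \<ge>\<^sub>q 0"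
      using assms by (intro eulerian_weights_dominate) simp_all
  qed
  then show ?thesis by (simp add: gen_eulerian_poly_eq_moment)
qed

end
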